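(* For all $d\geq 1$, every integer in $\{0,\ldots,m_d\}$ is the arithmetic genus of an arithmetically Cohen-Macaulay (aCM) curve of degree $d$, i.e. $\{0,\ldots,m_d\}\subseteq G_d$; and $m_d\geq \mathsf{g}^{\lceil d/2\rceil+2}$ for every $d\geq 18$.
   Context: Binomial expansion: for positive integers $a,t$ write uniquely $a=\binom{k(t)}{t}+\binom{k(t-1)}{t-1}+\cdots+\binom{k(j)}{j}$ with $k(t)>k(t-1)>\cdots>k(j)\geq j\geq 1$, and set $a^{\langle t\rangle}:=\binom{k(t)+1}{t+1}+\binom{k(t-1)+1}{t}+\cdots+\binom{k(j)+1}{j+1}$; also $0^{\langle t\rangle}:=0$. A function $\mathsf{h}:\mathbb{N}\to\mathbb{N}$ is an O-sequence if $\mathsf{h}(0)=1$ and $\mathsf{h}(t+1)\leq \mathsf{h}(t)^{\langle t\rangle}$ for every $t\geq 1$. It is finite if $\mathsf{h}(t)=0$ for some $t$ (and then for all larger arguments); a finite O-sequence is written $(h_0,\ldots,h_{s-1})$ with $h_{s-1}\neq 0$, $s$ is its length, and $\sum_{i=0}^{s-1}h_i$ is its multiplicity. The genus of $\mathsf{h}=(h_0,\ldots,h_{s-1})$ is $g(\mathsf{h}):=\sum_{j=2}^{s-1}(j-1)h_j$. $G_d$ is the set of all $g(\mathsf{h})$ for $\mathsf{h}$ a finite O-sequence of multiplicity $d$. By a well-known correspondence, the finite O-sequences of multiplicity $d$ are exactly the $h$-vectors of aCM projective curves of degree $d$, and $g(\mathsf{h})$ is the arithmetic genus of a curve with $h$-vector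 $\mathsf{h}$; so $G_d$ is the set of arithmetic genera of aCM curves of degree $d$. Set $\mathsf{g}^s:=\binom{s-1}{2}$. The sequence $\{m_d\}_{d\geq 1}$ is defined recursively: $m_1:=0$; for $d\geq 2$, start with $M:=m_{d-1}$; then, for $k=2,3,\ldots,d-1$ in this order, if $\binom{k}{2}-1\leq M$ (with the current value of $M$), replace $M$ by $\max\{M,\ m_{d-k}+\binom{k}{2}\}$; finally $m_d:=M$. *)

theory Defs
  imports Complex_Main
begin

text \<open>
  \<open>binom_expansion a t j k\<close>: the numbers \<open>k j < \<dots> < k t\<close> form the \<open>t\<close>-binomial (Macaulay)
  expansion of \<open>a\<close>. Only the values of \<open>k\<close> on \<open>{j..t}\<close> are relevant.
\<close>
definition binom_expansion :: "nat \<Rightarrow> nat \<Rightarrow> nat \<Rightarrow> (nat \<Rightarrow> nat) \<Rightarrow> bool" where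
  "binom_expansion a t j k \<longleftrightarrow>
     1 \<le> j \<and> j \<le> t \<and> j \<le> k j \<and> strict_mono_on {j..t} k \<and>
     a = (\<Sum>i=j..t. k i choose i)"

text \<open>
  \<open>macaulay_up a t\<close> is \<open>a\<^sup>\<langle>\<^sup>t\<^sup>\<rangle>\<close>. For \<open>a, t \<ge> 1\<close> the expansion exists and is unique on \<open>{j..t}\<close>, so the
  description is proper; \<open>t = 0\<close> is never used.
\<close>
definition macaulay_up :: "nat \<Rightarrow> nat \<Rightarrow> nat" where
  "macaulay_up a t =
     (if a = 0 then 0
      else (THE b. \<exists>j k. binom_expansion a t j k \<and> b = (\<Sum>i=j..t. (k i + 1) choose (i + 1))))"

definition O_sequence :: "(nat \<Rightarrow> nat) \<Rightarrow> bool" where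
  "O_sequence h \<longleftrightarrow> h 0 = 1 \<and> (\<forall>t\<ge>1. h (t + 1) \<le> macaulay_up (h t) t)"

definition finite_O_sequence :: "(nat \<Rightarrow> nat) \<Rightarrow> bool" where
  "finite_O_sequence h \<longleftrightarrow> O_sequence h \<and> (\<exists>t. h t = 0)"

text \<open>
  The length \<open>s\<close> of a finite O-sequence \<open>(h\<^sub>0, \<dots>, h\<^sub>s\<^sub>-\<^sub>1)\<close>: an O-sequence vanishes from its first
  zero onwards, so \<open>s\<close> is the position of that zero.
\<close>
definition oseq_length :: "(nat \<Rightarrow> nat) \<Rightarrow> nat" where
  "oseq_length h = (LEAST t. h t = 0)"

definition multiplicity_oseq :: "(nat \<Rightarrow> nat) \<Rightarrow> nat" where
  "multiplicity_oseq h = (\<Sum>i<oseq_length h. h i)"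

definition genus_oseq :: "(nat \<Rightarrow> nat) \<Rightarrow> nat" where
  "genus_oseq h = (\<Sum>j=2..<oseq_length h. (j - 1) * h j)"

text \<open>
  \<open>acm_genera d\<close> is the set \<open>G\<^sub>d\<close>. Finite O-sequences of multiplicity \<open>d\<close> are exactly the
  \<open>h\<close>-vectors of aCM curves of degree \<open>d\<close>, and \<open>genus_oseq\<close> is then the arithmetic genus.
\<close>
definition acm_genera :: "nat \<Rightarrow> nat set" where
  "acm_genera d = {genus_oseq h | h. finite_O_sequence h \<and> multiplicity_oseq h = d}"

definition g_upper :: "nat \<Rightarrow> nat" where
  "g_upper s = (s - 1) choose 2"

text \<open>
  The sequence \<open>m\<^sub>d\<close>; the fold runs through \<open>k = 2, \<dots>, d - 1\<close> in increasing order with the current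
  value \<open>M\<close> as accumulator. The value at \<open>d = 0\<close> is a dummy.
\<close>
fun m_seq :: "nat \<Rightarrow> nat" where
  "m_seq d =
     (if d \<le> 1 then 0
      else fold (\<lambda>k M. if (k choose 2) - 1 \<le> M then max M (m_seq (d - k) + (k choose 2)) else M)
             [2..<d] (m_seq (d - 1)))"

declare m_seq.simps [simp del]

end

theory Submission
  imports Defs
begin

text \<open>
  Adding the sequence \<open>(0, 1, \<dots>, 1)\<close> with \<open>k\<close> ones to a finite O-sequence yields a finite O-sequence
  again, because \<open>a \<mapsto> a\<^sup>\<langle>\<^sup>t\<^sup>\<rangle>\<close> is strictly increasing; it raises the multiplicity by \<open>k\<close> and the genus by
  \<open>k choose 2\<close>. Hence \<open>G\<^bsub>d-k\<^esub> + (k choose 2) \<subseteq> G\<^sub>d\<close>. So \<open>{0..M} \<subseteq> G\<^sub>d\<close> is an invariant of the recursion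
  for \<open>m\<^sub>d\<close>: the test \<open>(k choose 2) - 1 \<le> M\<close> says that the new interval starting at \<open>k choose 2\<close>
  leaves no gap.

  For the lower bound, \<open>m\<^bsub>2e\<^esub> \<ge> (e + 1 choose 2)\<close> makes \<open>k = e + 1\<close> admissible in degree \<open>2e + 1\<close>, so that
  \<open>m\<^bsub>2e+1\<^esub> \<ge> m\<^sub>e + (e + 1 choose 2) \<ge> (e + 2 choose 2)\<close> as soon as \<open>m\<^sub>e > e\<close>, which holds for \<open>e \<ge> 9\<close>.
\<close>

section \<open>Binomial expansions: leading terms, comparison, existence\<close>

text \<open>Peeling off the leading term drives the inductions on \<open>t\<close>. An expansion
  consults only the values on \<open>{j..t}\<close>, so the same \<open>j\<close> and
  \<open>k\<close> serve for the remainder.\<close>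

lemma binom_expansion_Suc_cases:
  assumes "binom_expansion a (Suc t) j k"
  obtains (single) "j = Suc t" "Suc t \<le> k (Suc t)" "a = k (Suc t) choose Suc t"
  | (more) b where "1 \<le> t" "binom_expansion b t j k" "k t < k (Suc t)" "Suc t \<le> k (Suc t)"
      "a = b + (k (Suc t) choose Suc t)"
proof (cases "j = Suc t")
  case True
  with assms show ?thesis
    by (intro single) (auto simp: binom_expansion_def)
next
  case False
  with assms have j: "1 \<le> j" "j \<le> t" "j \<le> k j" and mono: "strict_mono_on {j..Suc t} k"
    and a: "a = (\<Sum>i=j..Suc t. k i choose i)"
    by (auto simp: binom_expansion_def)
  have "binom_expansion (\<Sum>i=j..t. k i choose i) t j k"
    using j mono by (auto simp: binom_expansion_def strict_mono_on_def)
  moreover have less_Suc: "k i < k (Suc i)" if "j \<le> i" "i \<le> t" for i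
    using mono that j by (auto simp: strict_mono_on_def)
  moreover have "i \<le> k i" if "j \<le> i" "i \<le> Suc t" for i
    using that
  proof (induction i rule: dec_induct)
    case base
    show ?case by (rule j(3))
  next
    case (step i)
    then show ?case using less_Suc[of i] by simp
  qed
  ultimately show ?thesis
    using j less_Suc[of t] a by (intro more) auto
qed

lemma binom_expansion_top_le:
  assumes "binom_expansion a t j k"
  shows "t \<le> k t" and "k t choose t \<le> a"
proof -
  from assms have "t \<noteq> 0"
    by (auto simp: binom_expansion_def)
  then obtain s where [simp]: "t = Suc s"
    using not0_implies_Suc by blast
  from assms[simplified] show "t \<le> k t" "k t choose t \<le> a"
    by (cases rule: binom_expansion_Suc_cases; simp)+
qed

lemma binom_expansion_pos:
  assumes "binom_expansion a t j k"
  shows "0 < a"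
proof -
  have "0 < k t choose t"
    using binom_expansion_top_le(1)[OF assms] by simp
  also have "\<dots> \<le> a"
    by (rule binom_expansion_top_le(2)[OF assms])
  finally show ?thesis .
qed

text \<open>By induction the lower terms sum to less than \<open>k (Suc t) choose t\<close>, and
  Pascal's rule combines this with the leading term \<open>k (Suc t) choose Suc t\<close>.\<close>

lemma binom_expansion_less:
  "binom_expansion a t j k \<Longrightarrow> a < Suc (k t) choose t"
proof (induction t arbitrary: a)
  case 0
  then show ?case by (auto simp: binom_expansion_def)
next
  case (Suc t)
  from Suc.prems show ?case
  proof (cases rule: binom_expansion_Suc_cases)
    case single
    then show ?thesis by simp
  next
    case (more b)
    have "b < Suc (k t) choose t"
      using more by (intro Suc.IH)
    also have "\<dots> \<le> k (Suc t) choose t"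
      using more by (intro binomial_right_mono) simp
    finally show ?thesis
      using more by simp
  qed
qed

lemma binom_expansion_shift:
  assumes "binom_expansion a t j k"
  shows "binom_expansion (\<Sum>i=j..t. (k i + 1) choose (i + 1)) (Suc t) (Suc j) (\<lambda>i. Suc (k (i - 1)))"
proof -
  have "(\<Sum>i=Suc j..Suc t. Suc (k (i - 1)) choose i) = (\<Sum>i=j..t. (k i + 1) choose (i + 1))"
    by (subst sum.shift_bounds_cl_Suc_ivl) simp
  moreover have "strict_mono_on {Suc j..Suc t} (\<lambda>i. Suc (k (i - 1)))"
    using assms by (auto simp: binom_expansion_def intro!: strict_mono_onI elim!: strict_mono_onD)
  ultimately show ?thesis
    using assms by (auto simp: binom_expansion_def)
qed

text \<open>
  Expansions are compared lexicographically from the top: if the leading terms differ, already they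
  decide, both for \<open>a, a'\<close> and, since the shift by one is again an expansion, for \<open>u, u'\<close>.
\<close>
lemma binom_expansion_compare:
  assumes "binom_expansion a t j k" and "binom_expansion a' t j' k'" and "a \<le> a'"
  defines "u \<equiv> \<Sum>i=j..t. (k i + 1) choose (i + 1)"
    and "u' \<equiv> \<Sum>i=j'..t. (k' i + 1) choose (i + 1)"
  shows "u \<le> u' \<and> (a < a' \<longrightarrow> u < u')"
  using assms(1-3) unfolding u_def u'_def
proof (induction t arbitrary: a a')
  case 0
  then show ?case by (auto simp: binom_expansion_def)
next
  case (Suc t)
  define u where "u = (\<Sum>i=j..Suc t. (k i + 1) choose (i + 1))"
  define u' where "u' = (\<Sum>i=j'..Suc t. (k' i + 1) choose (i + 1))"
  have u: "binom_expansion u (Suc (Suc t)) (Suc j) (\<lambda>i. Suc (k (i - 1)))"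
    unfolding u_def by (rule binom_expansion_shift[OF Suc.prems(1)])
  have u': "binom_expansion u' (Suc (Suc t)) (Suc j') (\<lambda>i. Suc (k' (i - 1)))"
    unfolding u'_def by (rule binom_expansion_shift[OF Suc.prems(2)])
  consider "k (Suc t) < k' (Suc t)" | "k (Suc t) = k' (Suc t)" | "k' (Suc t) < k (Suc t)"
    by linarith
  then have "u \<le> u' \<and> (a < a' \<longrightarrow> u < u')"
  proof cases
    case 1
    have "u < Suc (Suc (k (Suc t))) choose Suc (Suc t)"
      using binom_expansion_less[OF u] by simp
    also have "\<dots> \<le> Suc (k' (Suc t)) choose Suc (Suc t)"
      using 1 by (intro binomial_right_mono) simp
    also have "\<dots> \<le> u'"
      using binom_expansion_top_le(2)[OF u'] by simp
    finally show ?thesis by simp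
  next
    case 2
    \<comment> \<open>With equal leading numbers the leading terms cancel and the tails decide. If
      only one expansion has a tail, then that tail and its shift are both positive.\<close>
    have split: "(\<Sum>i=l..Suc t. (f i + 1) choose (i + 1))
        = (\<Sum>i=l..t. (f i + 1) choose (i + 1)) + (Suc (f (Suc t)) choose Suc (Suc t))"
      if "binom_expansion c t l f" for l c and f :: "nat \<Rightarrow> nat"
      using that by (simp add: binom_expansion_def del: binomial_Suc_Suc)
    from Suc.prems(1) show ?thesis
    proof (cases rule: binom_expansion_Suc_cases)
      case single: single
      from Suc.prems(2) show ?thesis
      proof (cases rule: binom_expansion_Suc_cases)
        case single': single
        then show ?thesis
          using single 2 by (simp add: u_def u'_def)
      next
        case more': (more b')
        have "u < u'"
          using binom_expansion_pos[OF binom_expansion_shift[OF more'(2)]] split[OF more'(2)] single 2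
          by (simp add: u_def u'_def del: binomial_Suc_Suc)
        then show ?thesis by simp
      qed
    next
      case more: (more b)
      from Suc.prems(2) show ?thesis
      proof (cases rule: binom_expansion_Suc_cases)
        case single': single
        then have "a' < a"
          using binom_expansion_pos[OF more(2)] more 2 by simp
        then show ?thesis
          using Suc.prems(3) by simp
      next
        case more': (more b')
        then show ?thesis
          using Suc.IH[OF more(2) more'(2)] split[OF more(2)] split[OF more'(2)]
            more(5) 2 Suc.prems(3)
          by (simp add: u_def u'_def del: binomial_Suc_Suc)
      qed
    qed
  next
    case 3
    have "a' < Suc (k' (Suc t)) choose Suc t"
      by (rule binom_expansion_less[OF Suc.prems(2)])
    also have "\<dots> \<le> k (Suc t) choose Suc t"
      using 3 by (intro binomial_right_mono) simp
    also have "\<dots> \<le> a"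
      by (rule binom_expansion_top_le(2)[OF Suc.prems(1)])
    finally show ?thesis
      using Suc.prems(3) by simp
  qed
  then show ?case unfolding u_def u'_def .
qed

text \<open>Greedy choice: with \<open>n\<close> maximal such that
  \<open>n choose Suc t \<le> a\<close>, Pascal's rule puts the remainder below
  \<open>n choose t\<close>. Hence the expansion of the remainder has all its numbers below
  \<open>n\<close>, and \<open>n\<close> can be placed on top.\<close>

lemma binom_expansion_exists:
  assumes "0 < a" and "0 < t"
  shows "\<exists>j k. binom_expansion a t j k"
  using assms
proof (induction t arbitrary: a)
  case 0
  then show ?case by simp
next
  case (Suc t)
  define n where "n = (GREATEST n. n choose Suc t \<le> a)"
  \<comment> \<open>From \<open>n = t\<close> on, the binomial coefficient grows by at least 1 per
    step. So the candidates for \<open>n\<close> are bounded and the \<open>GREATEST\<close> above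
    is attained.\<close>
  have "n \<le> (n choose Suc t) + t" for n
  proof (induction n)
    case (Suc n)
    show ?case
    proof (cases "t \<le> n")
      case True
      then have "1 \<le> n choose t"
        using zero_less_binomial by (metis One_nat_def Suc_leI)
      then show ?thesis
        using Suc.IH by simp
    qed simp
  qed simp
  then have bound: "n \<le> a + t" if "n choose Suc t \<le> a" for n
    using that by (meson add_le_mono1 order_trans)
  have n: "n choose Suc t \<le> a"
    unfolding n_def by (rule GreatestI_nat[where k = 0 and b = "a + t"]) (use bound in auto)
  have n_max: "n' \<le> n" if "n' choose Suc t \<le> a" for n'
    unfolding n_def by (rule Greatest_le_nat[where b = "a + t"]) (use bound that in auto)
  have "Suc t \<le> n"
    using Suc.prems by (intro n_max) simp
  have "a < Suc n choose Suc t"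
    using n_max[of "Suc n"] by fastforce
  then have r: "a - (n choose Suc t) < n choose t"
    using n by simp
  show ?case
  proof (cases "a = n choose Suc t")
    case True
    then have "binom_expansion a (Suc t) (Suc t) (\<lambda>_. n)"
      using \<open>Suc t \<le> n\<close> by (simp add: binom_expansion_def strict_mono_on_def)
    then show ?thesis by blast
  next
    case False
    \<comment> \<open>For \<open>t = 0\<close> the remainder would be below
      \<open>n choose 0 = 1\<close>, hence zero.\<close>
    with n r have "0 < t"
      by (cases t) auto
    with False n Suc.IH[of "a - (n choose Suc t)"] obtain j k
      where jk: "binom_expansion (a - (n choose Suc t)) t j k"
      by auto
    then have "k t choose t < n choose t"
      using binom_expansion_top_le(2) r by (meson le_less_trans)
    then have "k t < n"
      using binomial_right_mono[of n "k t" t] by (meson not_le)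
    from jk have mono: "strict_mono_on {j..t} k"
      by (simp add: binom_expansion_def)
    have below: "k i < n" if "j \<le> i" "i \<le> t" for i
    proof (cases "i = t")
      case False
      then have "k i < k t"
        using strict_mono_onD[OF mono] that by simp
      then show ?thesis
        using \<open>k t < n\<close> by simp
    qed (simp add: \<open>k t < n\<close>)
    have "binom_expansion a (Suc t) j (k(Suc t := n))"
      unfolding binom_expansion_def
    proof (intro conjI)
      show "strict_mono_on {j..Suc t} (k(Suc t := n))"
      proof (rule strict_mono_onI)
        fix r s assume "r \<in> {j..Suc t}" "s \<in> {j..Suc t}" "r < s"
        then show "(k(Suc t := n)) r < (k(Suc t := n)) s"
          using below[of r] strict_mono_onD[OF mono, of r s] by (cases "s = Suc t") auto
      qed
      show "a = (\<Sum>i=j..Suc t. (k(Suc t := n)) i choose i)"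
      proof -
        have "(\<Sum>i=j..t. k i choose i) = a - (n choose Suc t)" and "j \<le> t"
          using jk by (auto simp: binom_expansion_def)
        then show ?thesis
          using n by simp
      qed
    qed (use jk in \<open>auto simp: binom_expansion_def\<close>)
    then show ?thesis by blast
  qed
qed

section \<open>The Macaulay operator\<close>

text \<open>Uniqueness of the expansion itself is not invoked: comparing two expansions of the same
  \<open>a\<close> in both directions already gives equal shifted sums.\<close>

lemma macaulay_up_eq:
  assumes "binom_expansion a t j k"
  shows "macaulay_up a t = (\<Sum>i=j..t. (k i + 1) choose (i + 1))"
proof -
  have "(THE b. \<exists>j k. binom_expansion a t j k \<and> b = (\<Sum>i=j..t. (k i + 1) choose (i + 1)))
      = (\<Sum>i=j..t. (k i + 1) choose (i + 1))"
    using assms binom_expansion_compare by (intro the_equality) (blast intro: antisym)+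
  then show ?thesis
    using binom_expansion_pos[OF assms] by (simp add: macaulay_up_def)
qed

lemma macaulay_up_0 [simp]: "macaulay_up 0 t = 0"
  by (simp add: macaulay_up_def)

lemma macaulay_up_strict_mono:
  assumes "0 < t" and "a < b"
  shows "macaulay_up a t < macaulay_up b t"
proof -
  obtain j' k' where b: "binom_expansion b t j' k'"
    using binom_expansion_exists[of b t] assms by auto
  show ?thesis
  proof (cases "a = 0")
    case True
    then show ?thesis
      using binom_expansion_pos[OF binom_expansion_shift[OF b]] macaulay_up_eq[OF b] by simp
  next
    case False
    then obtain j k where a: "binom_expansion a t j k"
      using binom_expansion_exists[of a t] assms by auto
    show ?thesis
      unfolding macaulay_up_eq[OF a] macaulay_up_eq[OF b]
      using binom_expansion_compare[OF a b] \<open>a < b\<close> by linarith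
  qed
qed

section \<open>Finite O-sequences and the addition of a row of ones\<close>

lemma finite_O_sequence_zero:
  assumes "finite_O_sequence h" and "h t = 0" and "t \<le> n"
  shows "h n = 0"
  using assms(3)
proof (induction n rule: dec_induct)
  case base
  show ?case by (rule assms(2))
next
  case (step n)
  \<comment> \<open>The growth condition starts at 1; position 0 is excluded because
    \<open>h 0 = 1\<close>.\<close>
  then have "1 \<le> n"
    using assms(1) by (cases n) (auto simp: finite_O_sequence_def O_sequence_def)
  then have "h (n + 1) \<le> macaulay_up (h n) n"
    using assms(1) by (auto simp: finite_O_sequence_def O_sequence_def)
  then show ?case
    using step by simp
qed

text \<open>Any zero of \<open>h\<close> may replace its length as summation bound, so
  \<open>h\<close> and its modification can be summed over one range. The genus sum may start at 0,
  since the truncated factor \<open>i - 1\<close> vanishes at 0 and 1.\<close>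

lemma
  assumes "finite_O_sequence h" and "h N = 0"
  shows multiplicity_oseq_eq: "multiplicity_oseq h = (\<Sum>i<N. h i)"
    and genus_oseq_eq: "genus_oseq h = (\<Sum>i<N. (i - 1) * h i)"
proof -
  have le: "oseq_length h \<le> N"
    unfolding oseq_length_def by (rule Least_le) (rule assms(2))
  have "h (oseq_length h) = 0"
    unfolding oseq_length_def by (rule LeastI) (rule assms(2))
  then have zero: "h i = 0" if "oseq_length h \<le> i" for i
    using finite_O_sequence_zero[OF assms(1)] that by blast
  show "multiplicity_oseq h = (\<Sum>i<N. h i)"
    unfolding multiplicity_oseq_def using le zero by (intro sum.mono_neutral_left) auto
  show "genus_oseq h = (\<Sum>i<N. (i - 1) * h i)"
    unfolding genus_oseq_def
  proof (rule sum.mono_neutral_left)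
    show "\<forall>i\<in>{..<N} - {2..<oseq_length h}. (i - 1) * h i = 0"
      using zero by (auto simp: not_less_eq_eq not_le numeral_2_eq_2)
  qed (use le in auto)
qed

text \<open>Position 0 is spared to keep the value 1 there; \<open>k\<close> may exceed the last
  nonzero position of \<open>h\<close>.\<close>

definition add_row :: "nat \<Rightarrow> (nat \<Rightarrow> nat) \<Rightarrow> nat \<Rightarrow> nat" where
  "add_row k h i = h i + (if 1 \<le> i \<and> i \<le> k then 1 else 0)"

lemma finite_O_sequence_add_row:
  assumes "finite_O_sequence h"
  shows "finite_O_sequence (add_row k h)"
proof -
  from assms have h0: "h 0 = 1" and h: "\<And>t. 1 \<le> t \<Longrightarrow> h (t + 1) \<le> macaulay_up (h t) t"
    by (auto simp: finite_O_sequence_def O_sequence_def)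
  obtain N where "h N = 0"
    using assms by (auto simp: finite_O_sequence_def)
  then have "h (max N (Suc k)) = 0"
    using finite_O_sequence_zero[OF assms] by simp
  then have "add_row k h (max N (Suc k)) = 0"
    by (simp add: add_row_def)
  \<comment> \<open>For \<open>t < k\<close> the left side rises by 1 and strict monotonicity raises
    the bound by at least 1; for \<open>t = k\<close> only the bound rises; beyond that nothing
    changes.\<close>
  moreover have "add_row k h (t + 1) \<le> macaulay_up (add_row k h t) t" if "1 \<le> t" for t
    using h[OF that] macaulay_up_strict_mono[of t "h t" "Suc (h t)"] that
    by (auto simp: add_row_def)
  ultimately show ?thesis
    using h0 unfolding finite_O_sequence_def O_sequence_def by (auto simp: add_row_def[of k h 0])
qed

lemma acm_genera_add_row:
  assumes "g \<in> acm_genera d"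
  shows "g + (k choose 2) \<in> acm_genera (d + k)"
proof -
  obtain h where h: "finite_O_sequence h" and g: "g = genus_oseq h" and d: "d = multiplicity_oseq h"
    using assms unfolding acm_genera_def by blast
  obtain N where "h N = 0"
    using h by (auto simp: finite_O_sequence_def)
  define N' where "N' = max N (Suc k)"
  have N': "h N' = 0"
    unfolding N'_def using finite_O_sequence_zero[OF h \<open>h N = 0\<close>] by simp
  then have add_N': "add_row k h N' = 0"
    by (simp add: add_row_def N'_def)
  have k: "{..<N'} \<inter> {i. Suc 0 \<le> i \<and> i \<le> k} = {Suc 0..k}"
    by (auto simp: N'_def)
  have "multiplicity_oseq (add_row k h) = (\<Sum>i<N'. add_row k h i)"
    by (intro multiplicity_oseq_eq finite_O_sequence_add_row h add_N')
  also have "\<dots> = (\<Sum>i<N'. h i) + k"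
    by (simp add: add_row_def sum.distrib sum.If_cases k)
  also have "\<dots> = d + k"
    using multiplicity_oseq_eq[OF h N'] d by simp
  finally have "multiplicity_oseq (add_row k h) = d + k" .
  moreover have "genus_oseq (add_row k h) = g + (k choose 2)"
  proof -
    have "genus_oseq (add_row k h) = (\<Sum>i<N'. (i - 1) * add_row k h i)"
      by (intro genus_oseq_eq finite_O_sequence_add_row h add_N')
    also have "\<dots> = (\<Sum>i<N'. (i - 1) * h i + (if 1 \<le> i \<and> i \<le> k then i - 1 else 0))"
      by (intro sum.cong) (auto simp: add_row_def algebra_simps)
    also have "\<dots> = (\<Sum>i<N'. (i - 1) * h i) + (\<Sum>i=1..k. i - 1)"
      unfolding sum.distrib by (simp add: sum.If_cases k)
    also have "(\<Sum>i=1..k. i - 1) = (k choose 2)"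
      by (induction k) (simp_all add: numeral_2_eq_2)
    finally show ?thesis
      using genus_oseq_eq[OF h N'] g by simp
  qed
  ultimately show ?thesis
    using finite_O_sequence_add_row[OF h, of k] unfolding acm_genera_def
    by (intro CollectI exI[of _ "add_row k h"]) simp
qed

lemma acm_genera_1: "0 \<in> acm_genera 1"
proof -
  define h :: "nat \<Rightarrow> nat" where "h i = (if i = 0 then 1 else 0)" for i
  have "h 1 = 0"
    by (simp add: h_def)
  moreover have "h 0 = 1" "h (t + 1) = 0" for t
    by (simp_all add: h_def)
  ultimately have h: "finite_O_sequence h"
    unfolding finite_O_sequence_def O_sequence_def by (metis le0)
  have "multiplicity_oseq h = 1" "genus_oseq h = 0"
    unfolding multiplicity_oseq_eq[OF h \<open>h 1 = 0\<close>] genus_oseq_eq[OF h \<open>h 1 = 0\<close>]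
    by (simp_all add: \<open>h 0 = 1\<close>)
  then show ?thesis
    using h unfolding acm_genera_def by (intro CollectI exI[of _ h]) simp
qed

section \<open>The genera up to \<open>m_seq d\<close>\<close>

lemma m_seq_subset_acm_genera:
  "1 \<le> d \<Longrightarrow> {0..m_seq d} \<subseteq> acm_genera d"
proof (induction d rule: less_induct)
  case (less d)
  show ?case
  proof (cases "d = 1")
    case True
    then show ?thesis
      using acm_genera_1 by (simp add: m_seq.simps)
  next
    case False
    define f where "f = (\<lambda>k M. if (k choose 2) - 1 \<le> M then max M (m_seq (d - k) + (k choose 2)) else M)"
    have "{0..fold f [2..<d] (m_seq (d - 1))} \<subseteq> acm_genera d"
    proof (rule fold_invariant[where P = "\<lambda>M. {0..M} \<subseteq> acm_genera d" and Q = "\<lambda>k. k \<in> {2..<d}"])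
      show "{0..m_seq (d - 1)} \<subseteq> acm_genera d"
      proof
        fix g assume "g \<in> {0..m_seq (d - 1)}"
        then have "g \<in> acm_genera (d - 1)"
          using less.IH[of "d - 1"] less.prems False by (simp add: subset_iff)
        \<comment> \<open>A row of length 1 raises the multiplicity by 1 and keeps the genus, as
          \<open>1 choose 2 = 0\<close>.\<close>
        from acm_genera_add_row[OF this, of 1] show "g \<in> acm_genera d"
          using less.prems by (simp add: numeral_2_eq_2)
      qed
    next
      fix k M assume k: "k \<in> {2..<d}" and M: "{0..M} \<subseteq> acm_genera d"
      have "g \<in> acm_genera d" if "(k choose 2) - 1 \<le> M" "g \<le> m_seq (d - k) + (k choose 2)" for g
      proof (cases "g \<le> M")
        case True
        then show ?thesis using M by auto
      next
        case False
        have "g - (k choose 2) \<in> {0..m_seq (d - k)}"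
          using that by simp
        also have "\<dots> \<subseteq> acm_genera (d - k)"
          using k by (intro less.IH) auto
        finally have "g - (k choose 2) \<in> acm_genera (d - k)" .
        \<comment> \<open>Here \<open>g > M \<ge> (k choose 2) - 1\<close>, so
          \<open>k choose 2 \<le> g\<close> and the subtraction is not truncated.\<close>
        from acm_genera_add_row[OF this, of k] show ?thesis
          using False that k by simp
      qed
      then show "{0..f k M} \<subseteq> acm_genera d"
        using M by (auto simp: f_def le_max_iff_disj subset_iff)
    qed auto
    then show ?thesis
      using False less.prems by (subst m_seq.simps) (simp add: f_def)
  qed
qed

section \<open>Lower bounds for \<open>m_seq\<close>\<close>

text \<open>The accumulator of the fold never decreases. So a test passed by the initial value
  \<open>m_seq (d - 1)\<close> is still passed when \<open>k\<close> is reached, and the value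
  attained there survives to the end.\<close>

lemma
  assumes "2 \<le> d"
  shows m_seq_mono_step: "m_seq (d - 1) \<le> m_seq d"
    and m_seq_step: "2 \<le> k \<Longrightarrow> k < d \<Longrightarrow> (k choose 2) - 1 \<le> m_seq (d - 1)
      \<Longrightarrow> m_seq (d - k) + (k choose 2) \<le> m_seq d"
proof -
  define f where "f = (\<lambda>k M. if (k choose 2) - 1 \<le> M then max M (m_seq (d - k) + (k choose 2)) else M)"
  have m: "m_seq d = fold f [2..<d] (m_seq (d - 1))"
    using assms by (subst m_seq.simps) (simp add: f_def)
  have incr: "M \<le> fold f ks M" for ks M
  proof (induction ks arbitrary: M)
    case (Cons k ks)
    have "M \<le> f k M" by (simp add: f_def)
    also have "\<dots> \<le> fold f ks (f k M)" by (rule Cons.IH)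
    finally show ?case by simp
  qed simp
  show "m_seq (d - 1) \<le> m_seq d"
    unfolding m by (rule incr)
  assume k: "2 \<le> k" "k < d" and ch: "(k choose 2) - 1 \<le> m_seq (d - 1)"
  have split: "[2..<d] = [2..<k] @ k # [Suc k..<d]"
    using k by (metis le_add_diff_inverse less_imp_le upt_add_eq_append upt_conv_Cons)
  define M where "M = fold f [2..<k] (m_seq (d - 1))"
  have "(k choose 2) - 1 \<le> M"
    using ch incr[of "m_seq (d - 1)" "[2..<k]"] unfolding M_def by simp
  then have "m_seq (d - k) + (k choose 2) \<le> f k M"
    by (simp add: f_def)
  also have "\<dots> \<le> fold f [Suc k..<d] (f k M)"
    by (rule incr)
  also have "\<dots> = m_seq d"
    by (simp add: m split M_def)
  finally show "m_seq (d - k) + (k choose 2) \<le> m_seq d" .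
qed

lemma m_seq_mono:
  assumes "1 \<le> c" and "c \<le> d"
  shows "m_seq c \<le> m_seq d"
  using assms(2)
proof (induction d rule: dec_induct)
  case (step d)
  with assms(1) show ?case using m_seq_mono_step[of "Suc d"] by simp
qed simp

text \<open>The values at 9, 10, 11 start the induction for \<open>m_seq_gt\<close>, the one at 18
  that for \<open>m_seq_lower_bound\<close>. Each is found by a single unfolding, with the smaller
  values as rewrite rules.\<close>

lemma m_seq_values:
  "m_seq 9 = 11" "m_seq 10 = 13" "m_seq 11 = 18" "m_seq 18 = 52"
proof -
  have [simp]: "m_seq (Suc 0) = 0" by (simp add: m_seq.simps)
  have [simp]: "m_seq 2 = 0" by (subst m_seq.simps) (simp add: choose_two upt_rec_numeral)
  have [simp]: "m_seq 3 = 1" by (subst m_seq.simps) (simp add: choose_two upt_rec_numeral)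
  have [simp]: "m_seq 4 = 1" by (subst m_seq.simps) (simp add: choose_two upt_rec_numeral)
  have [simp]: "m_seq 5 = 3" by (subst m_seq.simps) (simp add: choose_two upt_rec_numeral)
  have [simp]: "m_seq 6 = 4" by (subst m_seq.simps) (simp add: choose_two upt_rec_numeral)
  have [simp]: "m_seq 7 = 4" by (subst m_seq.simps) (simp add: choose_two upt_rec_numeral)
  have [simp]: "m_seq 8 = 7" by (subst m_seq.simps) (simp add: choose_two upt_rec_numeral)
  have [simp]: "m_seq 9 = 11" by (subst m_seq.simps) (simp add: choose_two upt_rec_numeral)
  have [simp]: "m_seq 10 = 13" by (subst m_seq.simps) (simp add: choose_two upt_rec_numeral)
  have [simp]: "m_seq 11 = 18" by (subst m_seq.simps) (simp add: choose_two upt_rec_numeral)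
  have [simp]: "m_seq 12 = 19" by (subst m_seq.simps) (simp add: choose_two upt_rec_numeral)
  have [simp]: "m_seq 13 = 19" by (subst m_seq.simps) (simp add: choose_two upt_rec_numeral)
  have [simp]: "m_seq 14 = 25" by (subst m_seq.simps) (simp add: choose_two upt_rec_numeral)
  have [simp]: "m_seq 15 = 32" by (subst m_seq.simps) (simp add: choose_two upt_rec_numeral)
  have [simp]: "m_seq 16 = 40" by (subst m_seq.simps) (simp add: choose_two upt_rec_numeral)
  have [simp]: "m_seq 17 = 43" by (subst m_seq.simps) (simp add: choose_two upt_rec_numeral)
  have [simp]: "m_seq 18 = 52" by (subst m_seq.simps) (simp add: choose_two upt_rec_numeral)
  show "m_seq 9 = 11" "m_seq 10 = 13" "m_seq 11 = 18" "m_seq 18 = 52"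
    by simp_all
qed

text \<open>The choice \<open>k = 3\<close> raises both the degree and the bound by 3, as
  \<open>3 choose 2 = 3\<close>, so the inequality propagates in steps of 3 from three consecutive
  base cases. It fails at 8, where \<open>m_seq 8 = 7\<close>.\<close>

lemma m_seq_gt:
  "9 \<le> n \<Longrightarrow> n < m_seq n"
proof (induction n rule: less_induct)
  case (less n)
  consider "n = 9" | "n = 10" | "n = 11" | "12 \<le> n"
    using less.prems by linarith
  then show ?case
  proof cases
    case 4
    have "(3 choose 2) - 1 \<le> m_seq 9"
      by (simp add: m_seq_values choose_two)
    also have "\<dots> \<le> m_seq (n - 1)"
      using 4 by (intro m_seq_mono) simp_all
    finally have "m_seq (n - 3) + (3 choose 2) \<le> m_seq n"
      using 4 by (intro m_seq_step) simp_all
    moreover have "n - 3 < m_seq (n - 3)"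
      using 4 by (intro less.IH) simp_all
    ultimately show ?thesis
      by (simp add: choose_two)
  qed (simp_all add: m_seq_values)
qed

lemma m_seq_lower_bound_step:
  assumes "9 \<le> e" and "Suc e choose 2 \<le> m_seq (2 * e)"
  shows "Suc (Suc e) choose 2 \<le> m_seq (2 * e + 1)"
proof -
  have "Suc (Suc e) choose 2 = (Suc e choose 2) + Suc e"
    by (simp add: numeral_2_eq_2)
  also have "\<dots> \<le> m_seq (2 * e + 1 - Suc e) + (Suc e choose 2)"
    using m_seq_gt[of e] assms(1) by simp
  also have "\<dots> \<le> m_seq (2 * e + 1)"
    using assms by (intro m_seq_step) auto
  finally show ?thesis .
qed

text \<open>The whole gain from \<open>2 * e\<close> to \<open>2 * Suc e\<close> occurs at the odd
  degree in between; monotonicity carries it to the even one.\<close>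

lemma m_seq_lower_bound:
  "9 \<le> e \<Longrightarrow> Suc e choose 2 \<le> m_seq (2 * e)"
proof (induction e rule: dec_induct)
  case base
  show ?case by (simp add: m_seq_values choose_two)
next
  case (step e)
  have "Suc (Suc e) choose 2 \<le> m_seq (2 * e + 1)"
    using step by (intro m_seq_lower_bound_step)
  also have "\<dots> \<le> m_seq (2 * Suc e)"
    by (rule m_seq_mono) simp_all
  finally show ?case .
qed

theorem theorem5p4:
  shows "(\<forall>d::nat. 1 \<le> d \<longrightarrow> {0..m_seq d} \<subseteq> acm_genera d) \<and>
         (\<forall>d::nat. 18 \<le> d \<longrightarrow> g_upper (nat \<lceil>real d / 2\<rceil> + 2) \<le> m_seq d)"
proof (intro conjI allI impI)
  fix d :: nat
  assume "18 \<le> d"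
  show "g_upper (nat \<lceil>real d / 2\<rceil> + 2) \<le> m_seq d"
  proof (cases "even d")
    case True
    then obtain e where "d = 2 * e" by blast
    then show ?thesis
      using m_seq_lower_bound[of e] \<open>18 \<le> d\<close> by (simp add: g_upper_def)
  next
    case False
    then obtain e where e: "d = 2 * e + 1" by (blast elim: oddE)
    \<comment> \<open>Rounding up makes the target for \<open>2 * e + 1\<close> equal to
      \<open>Suc (Suc e) choose 2\<close>, the same as for degree \<open>2 * e + 2\<close>.\<close>
    then have "\<lceil>real d / 2\<rceil> = int e + 1"
      by (intro ceiling_unique) auto
    then have "nat \<lceil>real d / 2\<rceil> = Suc e"
      by simp
    then show ?thesis
      using m_seq_lower_bound_step[of e] m_seq_lower_bound[of e] e \<open>18 \<le> d\<close> by (simp add: g_upper_def)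
  qed
qed (rule m_seq_subset_acm_genera)

end
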